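(* Let $\eta$ be a non-periodic Toeplitz sequence with period structure $(p_n)_{n\ge1}$ and let $F$ be an automorphism of $(X_\eta,\sigma)$. Suppose that there are $A_n\subseteq\mathbb N$ ($n\in\mathbb N$) such that $$\bigcap_{n\in\mathbb N}\langle A_n\rangle=\{0\}\quad\text{and}\quad\widetilde{\mathcal H}_n\subseteq\mathcal M_{A_n}\ \ (n\in\mathbb N).$$ (a) Then $\partial W\cap(\partial W-\Delta(k))=\emptyset$ for all $k\in\mathbb Z\setminus\{0\}$, and there exists a unique $k\in\mathbb Z$ such that $\partial W+y_F\subseteq\partial W+\Delta(k)$. (b) With this $k$, $\tilde\tau_n\mid(y_F)_n-k$ for all $n$, where $\tilde\tau_n$ is the minimal period of $\widetilde{\mathcal H}_n$. In particular, if infinitely many $\widetilde{\mathcal H}_n$ have minimal period $p_n$, then $y_F=\Delta(k)$.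
   Context: $\mathbb N=\{1,2,\dots\}$. For $A\subseteq\mathbb N$, $\langle A\rangle$ is the subgroup of $\mathbb Z$ generated by $A$ and $\mathcal M_A=\bigcup_{a\in A}a\mathbb Z$. A non-periodic Toeplitz sequence with period structure $p_1\mid p_2\mid\dots\to\infty$ is a non-periodic $\eta\in\{0,1\}^{\mathbb Z}$ such that for each $k\in\mathbb Z$ there is $n\ge1$ with $\eta|_{k+p_n\mathbb Z}$ constant. $\sigma$ is the left shift and $X_\eta$ the orbit closure of $\eta$. For $i=0,1$: $\mathcal P_n^i=\{k\in\mathbb Z:\eta|_{k+p_n\mathbb Z}=i\}$; $\mathcal H_n=\mathbb Z\setminus(\mathcal P_n^0\cup\mathcal P_n^1)$ (holes at level $n$); essential holes: $\widetilde{\mathcal H}_N=\{k\in\mathcal H_N:\mathcal H_n\cap(k+p_N\mathbb Z)\neq\emptyset\ \forall n\ge N\}$, a $p_N$-periodic set. $G=\varprojlim\mathbb Z/p_n\mathbb Z$; $\Delta(k)=(k+p_n\mathbb Z)_n$; $Tg=g+\Delta(1)$; $U_n(h)=\{g\in G:g_n=h_n\}$; $V^i=\bigcup_{n}\bigcup_{k\in\mathcal P_n^i\cap[0,p_n)}U_n(\Delta(k))$; $W=\overline{V^1}=G\setminus V^0$ with boundary $\partial W=G\setminus(V^0\cup V^1)$. Standing assumption: $(G,T)$ is the maximal equicontinuous factor of $(X_\eta,\sigma)$, with factor map $\pi$ determined by $\pi(\eta)=\Delta(0)$. An automorphism is a homeomorphism $F$ of $X_\eta$ commuting with $\sigma$;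 $y_F\in G$ is the unique element with $\pi(F(x))=\pi(x)+y_F$ for all $x\in X_\eta$. Convention: an integer $t$ divides $z\in\mathbb Z/p_n\mathbb Z$ if $z\in t\cdot(\mathbb Z/p_n\mathbb Z)$. *)

theory Defs
  imports "HOL-Analysis.Analysis" "HOL-Computational_Algebra.Group_Closure"
begin

text \<open>Types of the form \<^typ>\<open>int \<Rightarrow> nat\<close> and \<^typ>\<open>nat \<Rightarrow> int\<close> carry the
  product topology of discrete spaces.  Levels are indexed from \<open>0\<close>, so \<open>p n\<close> stands
  for the period usually written \<open>p_(n+1)\<close>.\<close>

subsection \<open>Toeplitz sequences and their holes\<close>

definition toeplitz :: "(int \<Rightarrow> nat) \<Rightarrow> (nat \<Rightarrow> nat) \<Rightarrow> bool" where
  "toeplitz \<eta> p \<longleftrightarrow>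
     range \<eta> \<subseteq> {0, 1} \<and>
     (\<forall>n. 0 < p n) \<and> (\<forall>n. p n dvd p (Suc n)) \<and> filterlim p at_top sequentially \<and>
     (\<forall>k. \<exists>n. \<forall>j. \<eta> (k + int (p n) * j) = \<eta> k)"

definition periodic :: "(int \<Rightarrow> nat) \<Rightarrow> bool" where
  "periodic \<eta> \<longleftrightarrow> (\<exists>q>0. \<forall>k. \<eta> (k + q) = \<eta> k)"

definition per_part :: "(int \<Rightarrow> nat) \<Rightarrow> (nat \<Rightarrow> nat) \<Rightarrow> nat \<Rightarrow> nat \<Rightarrow> int set" where
  "per_part \<eta> p i n = {k. \<forall>j. \<eta> (k + int (p n) * j) = i}"

definition holes :: "(int \<Rightarrow> nat) \<Rightarrow> (nat \<Rightarrow> nat) \<Rightarrow> nat \<Rightarrow> int set" where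
  "holes \<eta> p n = - (per_part \<eta> p 0 n \<union> per_part \<eta> p 1 n)"

definition ess_holes :: "(int \<Rightarrow> nat) \<Rightarrow> (nat \<Rightarrow> nat) \<Rightarrow> nat \<Rightarrow> int set" where
  "ess_holes \<eta> p N =
     {k \<in> holes \<eta> p N. \<forall>n\<ge>N. holes \<eta> p n \<inter> range (\<lambda>j. k + int (p N) * j) \<noteq> {}}"

definition minimal_period :: "int set \<Rightarrow> nat" where
  "minimal_period S = (LEAST t. 0 < t \<and> (\<lambda>k. k + int t) ` S = S)"

definition multiples :: "nat set \<Rightarrow> int set" where
  "multiples A = (\<Union>a\<in>A. range (\<lambda>j. int a * j))"

subsection \<open>Topological dynamics\<close>

definition shift :: "(int \<Rightarrow> nat) \<Rightarrow> int \<Rightarrow> nat" where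
  "shift x = (\<lambda>k. x (k + 1))"

definition orbit_closure :: "(int \<Rightarrow> nat) \<Rightarrow> (int \<Rightarrow> nat) set" where
  "orbit_closure \<eta> = closure (range (\<lambda>m k. \<eta> (k + m)))"

definition automorphism_on ::
  "'a::topological_space set \<Rightarrow> ('a \<Rightarrow> 'a) \<Rightarrow> ('a \<Rightarrow> 'a) \<Rightarrow> bool" where
  "automorphism_on X S F \<longleftrightarrow> (\<exists>F'. homeomorphism X X F F') \<and> (\<forall>x\<in>X. F (S x) = S (F x))"

definition factor_map ::
  "'a::topological_space set \<Rightarrow> ('a \<Rightarrow> 'a) \<Rightarrow> 'b::topological_space set \<Rightarrow> ('b \<Rightarrow> 'b)
     \<Rightarrow> ('a \<Rightarrow> 'b) \<Rightarrow> bool" where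
  "factor_map X S Y R \<rho> \<longleftrightarrow> continuous_on X \<rho> \<and> \<rho> ` X = Y \<and> (\<forall>x\<in>X. \<rho> (S x) = R (\<rho> x))"

text \<open>On a compact metrizable space, equicontinuity does not depend on the choice of the
  compatible metric \<open>d\<close>.\<close>

definition equicontinuous_system :: "'a::topological_space set \<Rightarrow> ('a \<Rightarrow> 'a) \<Rightarrow> bool" where
  "equicontinuous_system Y R \<longleftrightarrow> compact Y \<and>
     (\<exists>R' d. homeomorphism Y Y R R' \<and>
        Metric_space Y d \<and> Metric_space.mtopology Y d = top_of_set Y \<and>
        (\<forall>\<epsilon>>0. \<exists>\<delta>>0. \<forall>x\<in>Y. \<forall>y\<in>Y. d x y < \<delta> \<longrightarrow>
           (\<forall>n. d ((R ^^ n) x) ((R ^^ n) y) < \<epsilon> \<and> d ((R' ^^ n) x) ((R' ^^ n) y) < \<epsilon>)))"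

text \<open>Maximality must be tested against all equicontinuous factors \<open>(Z, Q)\<close>.  Factors of a
  compact metrizable system are compact and metrizable, hence embed into the Hilbert cube; it
  is therefore no restriction to let \<open>Z\<close> range over the subsets of \<^typ>\<open>nat \<Rightarrow> real\<close>.\<close>

definition maximal_equicontinuous_factor ::
  "'a::topological_space set \<Rightarrow> ('a \<Rightarrow> 'a) \<Rightarrow> 'b::topological_space set \<Rightarrow> ('b \<Rightarrow> 'b)
     \<Rightarrow> ('a \<Rightarrow> 'b) \<Rightarrow> bool" where
  "maximal_equicontinuous_factor X S Y R \<pi> \<longleftrightarrow>
     equicontinuous_system Y R \<and> factor_map X S Y R \<pi> \<and>
     (\<forall>(Z :: (nat \<Rightarrow> real) set) Q \<rho>.
        equicontinuous_system Z Q \<and> factor_map X S Z Q \<rho> \<longrightarrow>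
        (\<exists>q. factor_map Y R Z Q q \<and> (\<forall>x\<in>X. \<rho> x = q (\<pi> x))))"

subsection \<open>The odometer\<close>

text \<open>An element of \<open>\<Z>/p_n\<Z>\<close> is represented by its residue in \<open>{0..<p_n}\<close>.\<close>

definition odometer :: "(nat \<Rightarrow> nat) \<Rightarrow> (nat \<Rightarrow> int) set" where
  "odometer p = {g. (\<forall>n. g n \<in> {0..<int (p n)}) \<and> (\<forall>m n. m \<le> n \<longrightarrow> g n mod int (p m) = g m)}"

definition odo_add :: "(nat \<Rightarrow> nat) \<Rightarrow> (nat \<Rightarrow> int) \<Rightarrow> (nat \<Rightarrow> int) \<Rightarrow> nat \<Rightarrow> int" where
  "odo_add p g h = (\<lambda>n. (g n + h n) mod int (p n))"

definition odo_diff :: "(nat \<Rightarrow> nat) \<Rightarrow> (nat \<Rightarrow> int) \<Rightarrow> (nat \<Rightarrow> int) \<Rightarrow> nat \<Rightarrow> int" where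
  "odo_diff p g h = (\<lambda>n. (g n - h n) mod int (p n))"

definition odo_Delta :: "(nat \<Rightarrow> nat) \<Rightarrow> int \<Rightarrow> nat \<Rightarrow> int" where
  "odo_Delta p k = (\<lambda>n. k mod int (p n))"

definition odo_rot :: "(nat \<Rightarrow> nat) \<Rightarrow> (nat \<Rightarrow> int) \<Rightarrow> nat \<Rightarrow> int" where
  "odo_rot p g = odo_add p g (odo_Delta p 1)"

definition cylinder :: "(nat \<Rightarrow> nat) \<Rightarrow> nat \<Rightarrow> (nat \<Rightarrow> int) \<Rightarrow> (nat \<Rightarrow> int) set" where
  "cylinder p n h = {g \<in> odometer p. g n = h n}"

definition V_set :: "(int \<Rightarrow> nat) \<Rightarrow> (nat \<Rightarrow> nat) \<Rightarrow> nat \<Rightarrow> (nat \<Rightarrow> int) set" where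
  "V_set \<eta> p i =
     (\<Union>n. \<Union>k \<in> per_part \<eta> p i n \<inter> {0..<int (p n)}. cylinder p n (odo_Delta p k))"

definition W_set :: "(int \<Rightarrow> nat) \<Rightarrow> (nat \<Rightarrow> nat) \<Rightarrow> (nat \<Rightarrow> int) set" where
  "W_set \<eta> p = top_of_set (odometer p) closure_of V_set \<eta> p 1"

definition bd_W :: "(int \<Rightarrow> nat) \<Rightarrow> (nat \<Rightarrow> nat) \<Rightarrow> (nat \<Rightarrow> int) set" where
  "bd_W \<eta> p = top_of_set (odometer p) frontier_of W_set \<eta> p"

text \<open>The element \<open>y_F\<close>, for \<open>X = X_\<eta>\<close>.\<close>

definition odo_shift_of ::
  "(nat \<Rightarrow> nat) \<Rightarrow> 'a set \<Rightarrow> ('a \<Rightarrow> nat \<Rightarrow> int) \<Rightarrow> ('a \<Rightarrow> 'a) \<Rightarrow> nat \<Rightarrow> int" where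
  "odo_shift_of p X \<pi> F = (THE y. y \<in> odometer p \<and> (\<forall>x\<in>X. \<pi> (F x) = odo_add p (\<pi> x) y))"

text \<open>Divisibility by \<open>t\<close> in \<open>\<Z>/m\<Z>\<close>; the last argument is any representative.\<close>

definition residue_dvd :: "nat \<Rightarrow> nat \<Rightarrow> int \<Rightarrow> bool" where
  "residue_dvd m t z \<longleftrightarrow> (\<exists>w. z mod int m = (int t * w) mod int m)"

subsection \<open>The usual descriptions of the window and its boundary\<close>

lemma cylinder_open: "openin (top_of_set (odometer p)) (cylinder p n h)"
proof -
  have "open ((\<lambda>g::nat \<Rightarrow> int. g n) -` {h n})"
    by (intro open_vimage open_discrete) (simp add: continuous_on_product_coordinates)
  moreover have "cylinder p n h = odometer p \<inter> (\<lambda>g. g n) -` {h n}"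
    by (auto simp: cylinder_def)
  ultimately show ?thesis
    by (metis openin_open)
qed

lemma V_set_open: "openin (top_of_set (odometer p)) (V_set \<eta> p i)"
  unfolding V_set_def by (intro openin_Union ballI) (auto intro: cylinder_open)

lemma V_set_subset: "V_set \<eta> p i \<subseteq> odometer p"
  by (auto simp: V_set_def cylinder_def)

lemma cylinder_basis:
  assumes "openin (top_of_set (odometer p)) S" "g \<in> S"
  obtains n where "cylinder p n g \<subseteq> S"
proof -
  obtain B where B: "open B" "S = odometer p \<inter> B"
    using assms(1) by (auto simp: openin_open)
  have "openin (product_topology (\<lambda>_. euclidean) UNIV) B"
    using B(1) by (simp add: open_fun_def)
  then obtain X where X: "g \<in> Pi\<^sub>E UNIV X" "finite {i. X i \<noteq> UNIV}" "Pi\<^sub>E UNIV X \<subseteq> B"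
    using product_topology_open_contains_basis[of "\<lambda>_. euclidean" UNIV B g] assms(2) B(2) by auto
  obtain N where N: "\<forall>i \<in> {i. X i \<noteq> UNIV}. i \<le> N"
    using X(2) finite_nat_set_iff_bounded_le by auto
  have "h \<in> S" if h: "h \<in> cylinder p N g" for h
  proof -
    have "h i \<in> X i" for i
    proof (cases "X i = UNIV")
      case False
      then have "i \<le> N" using N by auto
      moreover have "h \<in> odometer p" "g \<in> odometer p" "h N = g N"
        using h assms(2) B(2) by (auto simp: cylinder_def)
      ultimately have "h i = g i"
        unfolding odometer_def by (metis (mono_tags, lifting) mem_Collect_eq)
      then show ?thesis using X(1) by auto
    qed auto
    then have "h \<in> B" using X(3) by auto
    then show ?thesis using h B(2) by (auto simp: cylinder_def)
  qed
  then show ?thesis using that by blast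
qed

lemma odo_Delta_in:
  assumes "toeplitz \<eta> p" shows "odo_Delta p k \<in> odometer p"
proof -
  have "p m dvd p n" if "m \<le> n" for m n
    using that
  proof (induction rule: dec_induct)
    case (step r)
    have "p r dvd p (Suc r)" using assms by (simp add: toeplitz_def)
    then show ?case using step.IH dvd_trans by blast
  qed simp
  then show ?thesis
    using assms by (auto simp: odometer_def odo_Delta_def toeplitz_def mod_mod_cancel)
qed

lemma per_part_mod: "k \<in> per_part \<eta> p i n \<longleftrightarrow> k mod int (p n) \<in> per_part \<eta> p i n"
proof -
  have *: "k \<in> per_part \<eta> p i n \<Longrightarrow> k + int (p n) * j \<in> per_part \<eta> p i n" for k j
    by (simp add: per_part_def) (metis add.assoc distrib_left)
  show ?thesis
    using *[of k "- (k div int (p n))"] *[of "k mod int (p n)" "k div int (p n)"]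
    by (auto simp: minus_mult_div_eq_mod)
qed

lemma V_set_iff:
  assumes "toeplitz \<eta> p"
  shows "g \<in> V_set \<eta> p i \<longleftrightarrow> g \<in> odometer p \<and> (\<exists>n. g n \<in> per_part \<eta> p i n)"
proof
  assume "g \<in> V_set \<eta> p i"
  then show "g \<in> odometer p \<and> (\<exists>n. g n \<in> per_part \<eta> p i n)"
    using per_part_mod by (auto simp: V_set_def cylinder_def odo_Delta_def)
next
  assume a: "g \<in> odometer p \<and> (\<exists>n. g n \<in> per_part \<eta> p i n)"
  then obtain n where n: "g n \<in> per_part \<eta> p i n" by blast
  have "g n \<in> {0..<int (p n)}" using a by (auto simp: odometer_def)
  then show "g \<in> V_set \<eta> p i"
    unfolding V_set_def cylinder_def odo_Delta_def using a n
    by (auto intro!: exI[of _ n] bexI[of _ "g n"])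
qed

lemma Delta_in_V_set:
  assumes "toeplitz \<eta> p" shows "odo_Delta p k \<in> V_set \<eta> p (\<eta> k)"
proof -
  obtain n where "\<forall>j. \<eta> (k + int (p n) * j) = \<eta> k"
    using assms unfolding toeplitz_def by blast
  then have "k \<in> per_part \<eta> p (\<eta> k) n" by (simp add: per_part_def)
  then show ?thesis
    using assms odo_Delta_in by (auto simp: V_set_iff odo_Delta_def) (metis per_part_mod)
qed

lemma V_set_disjoint:
  assumes "toeplitz \<eta> p" "i \<noteq> j" shows "V_set \<eta> p i \<inter> V_set \<eta> p j = {}"
proof (rule ccontr)
  assume "V_set \<eta> p i \<inter> V_set \<eta> p j \<noteq> {}"
  then obtain g m n where g: "g \<in> odometer p"
    and m: "g m \<in> per_part \<eta> p i m" and n: "g n \<in> per_part \<eta> p j n"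
    using assms(1) by (auto simp: V_set_iff)
  have *: "g (max m n) \<in> per_part \<eta> p l r" if "g r \<in> per_part \<eta> p l r" "r \<le> max m n" for l r
  proof -
    have "g (max m n) mod int (p r) = g r" using g that(2) by (auto simp: odometer_def)
    then show ?thesis using that(1) per_part_mod by metis
  qed
  have "\<eta> (g (max m n)) = i" "\<eta> (g (max m n)) = j"
    using *[OF m] *[OF n] by (auto simp: per_part_def dest: spec[of _ 0])
  then show False using assms(2) by simp
qed

lemma closure_of_V_set:
  assumes "toeplitz \<eta> p" "{i, j} = {0, 1}"
  shows "top_of_set (odometer p) closure_of V_set \<eta> p i = odometer p - V_set \<eta> p j"
proof
  have "i \<noteq> j" using assms(2) by (auto simp: doubleton_eq_iff)
  then have "V_set \<eta> p i \<subseteq> odometer p - V_set \<eta> p j"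
    using V_set_disjoint[OF assms(1)] V_set_subset by blast
  then show "top_of_set (odometer p) closure_of V_set \<eta> p i \<subseteq> odometer p - V_set \<eta> p j"
    by (rule closure_of_minimal) (metis V_set_open closedin_diff closedin_topspace topspace_euclidean_subtopology)
next
  show "odometer p - V_set \<eta> p j \<subseteq> top_of_set (odometer p) closure_of V_set \<eta> p i"
  proof
    fix g assume g: "g \<in> odometer p - V_set \<eta> p j"
    have "\<exists>y\<in>V_set \<eta> p i. y \<in> S" if S: "g \<in> S" "openin (top_of_set (odometer p)) S" for S
    proof -
      obtain n where n: "cylinder p n g \<subseteq> S"
        using cylinder_basis S by blast
      have "g n \<notin> per_part \<eta> p j n" using g assms(1) by (auto simp: V_set_iff)
      then obtain l where l: "\<eta> (g n + int (p n) * l) \<noteq> j" by (auto simp: per_part_def)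
      define k where "k = g n + int (p n) * l"
      have "\<eta> k \<in> {0, 1}" using assms(1) by (auto simp: toeplitz_def)
      then have "\<eta> k = i" using l assms(2) by (auto simp: k_def)
      moreover have "odo_Delta p k \<in> cylinder p n g"
        using g odo_Delta_in[OF assms(1)]
        by (auto simp: cylinder_def odo_Delta_def k_def odometer_def)
      ultimately show ?thesis
        using Delta_in_V_set[OF assms(1), of k] n by auto
    qed
    then show "g \<in> top_of_set (odometer p) closure_of V_set \<eta> p i"
      using g by (auto simp: in_closure_of)
  qed
qed

lemma W_set_eq:
  assumes "toeplitz \<eta> p" shows "W_set \<eta> p = odometer p - V_set \<eta> p 0"
  unfolding W_set_def using closure_of_V_set[OF assms, of 1 0] by auto

lemma bd_W_eq:
  assumes "toeplitz \<eta> p" shows "bd_W \<eta> p = odometer p - (V_set \<eta> p 0 \<union> V_set \<eta> p 1)"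
proof -
  have "odometer p - W_set \<eta> p = V_set \<eta> p 0"
    using W_set_eq[OF assms] V_set_subset by blast
  then have "bd_W \<eta> p = (top_of_set (odometer p) closure_of W_set \<eta> p)
      \<inter> (top_of_set (odometer p) closure_of V_set \<eta> p 0)"
    by (simp add: bd_W_def frontier_of_closures)
  also have "top_of_set (odometer p) closure_of W_set \<eta> p = W_set \<eta> p"
    by (simp add: W_set_def)
  finally show ?thesis
    using closure_of_V_set[OF assms, of 0 1] W_set_eq[OF assms] by auto
qed

end

theory Submission
  imports Defs
begin

text \<open>The fibre of \<open>\<pi>\<close> over \<open>g\<close> is a single point exactly when no \<open>g + \<Delta>(k)\<close> lies in
  \<open>\<partial>W\<close>.  Since \<open>F\<close> maps the fibre over \<open>g\<close> injectively into the fibre over \<open>g + y_F\<close>, every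
  \<open>g \<in> \<partial>W\<close> satisfies \<open>g + y_F \<in> \<partial>W + \<Delta>(k)\<close> for some \<open>k\<close>.  The essential holes at level \<open>n\<close> are
  the integers congruent to \<open>g_n\<close> for some \<open>g \<in> \<partial>W\<close>; they, and with them \<open>p_n\<close>, lie in
  \<open>\<langle>A_n\<rangle>\<close>.  Hence \<open>k\<close> is congruent to \<open>(y_F)_n\<close> modulo \<open>\<langle>A_n\<rangle>\<close> whatever \<open>g\<close> is, and
  \<open>\<Inter>\<langle>A_n\<rangle> = {0}\<close> leaves only one \<open>k\<close>.  Projecting
  \<open>\<partial>W + y_F - \<Delta>(k) \<subseteq> \<partial>W\<close> to level \<open>n\<close> shows that \<open>(y_F)_n - k\<close> is a period of the
  essential holes.\<close>

subsection \<open>Topological preliminaries\<close>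

text \<open>The preimage of an isolated value is relatively open, so it meets the dense set
  \<open>S\<close>. This transfers facts about finitely many discrete coordinates from the orbit of
  \<open>\<eta>\<close> to every point of the orbit closure.\<close>

lemma closure_attains_isolated_value:
  assumes "continuous_on (closure S) f" "x \<in> closure S" "open {f x}"
  shows "\<exists>s\<in>S. f s = f x"
proof -
  obtain U where U: "open U" "U \<inter> closure S = f -` {f x} \<inter> closure S"
    using assms(1,3) unfolding continuous_on_open_invariant by blast
  have "x \<in> U" using U(2) assms(2) by blast
  then obtain s where s: "s \<in> S" "s \<in> U"
    using assms(2) U(1) by (metis disjoint_iff open_Int_closure_eq_empty)
  then have "s \<in> U \<inter> closure S" using closure_subset by blast
  then show ?thesis using U(2) s(1) by auto
qed

text \<open>Finite intersection property: any finite set of indices lies in an initial segment.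
  Below, integers meet finitely many level conditions at a time, and this produces a point that
  meets all of them.\<close>

lemma compact_sequence_intersection:
  fixes C :: "nat \<Rightarrow> 'a::topological_space set"
  assumes "compact K" "\<And>n. closed (C n)" "\<And>n. \<exists>x\<in>K. \<forall>m\<le>n. x \<in> C m"
  shows "\<exists>x\<in>K. \<forall>n. x \<in> C n"
proof -
  have "K \<inter> (\<Inter>i\<in>UNIV. C i) \<noteq> {}"
  proof (rule compact_imp_fip_image[OF assms(1)])
    fix I :: "nat set" assume "finite I"
    then obtain n where n: "\<forall>i\<in>I. i \<le> n" using finite_nat_set_iff_bounded_le by auto
    obtain x where "x \<in> K" "\<forall>m\<le>n. x \<in> C m" using assms(3) by blast
    then show "K \<inter> (\<Inter>i\<in>I. C i) \<noteq> {}" using n by blast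
  qed (use assms(2) in auto)
  then show ?thesis by blast
qed

lemma compact_PiE_UNIV:
  fixes K :: "'i \<Rightarrow> 'b::topological_space set"
  assumes "\<And>i. compact (K i)"
  shows "compact (Pi\<^sub>E UNIV K)"
proof -
  have "compactin (product_topology (\<lambda>_. euclidean) UNIV) (Pi\<^sub>E UNIV K)"
    using assms by (simp add: compactin_PiE)
  then show ?thesis by (simp add: euclidean_product_topology)
qed

lemma closed_coordinate_vimage:
  fixes S :: "'b::discrete_topology set"
  shows "closed ((\<lambda>x::'i \<Rightarrow> 'b. x i) -` S)"
  by (intro closed_vimage) (simp_all add: closed_def open_discrete)

subsection \<open>Odometer and holes\<close>

lemma toeplitz_dvd:
  assumes "toeplitz \<eta> p" "m \<le> n" shows "p m dvd p n"
  using assms(2)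
proof (induction rule: dec_induct)
  case (step r)
  have "p r dvd p (Suc r)" using assms(1) by (simp add: toeplitz_def)
  then show ?case using step.IH dvd_trans by blast
qed simp

lemma toeplitz_pos: "toeplitz \<eta> p \<Longrightarrow> 0 < p n"
  by (simp add: toeplitz_def)

lemma odometer_mod: "g \<in> odometer p \<Longrightarrow> g n mod int (p n) = g n"
  by (auto simp: odometer_def)

lemma odo_add_in:
  assumes "toeplitz \<eta> p" "g \<in> odometer p" "h \<in> odometer p"
  shows "odo_add p g h \<in> odometer p"
proof -
  have "(g n + h n) mod int (p n) mod int (p m) = (g m + h m) mod int (p m)" if "m \<le> n" for m n
  proof -
    have "g n mod int (p m) = g m" "h n mod int (p m) = h m"
      using assms that by (auto simp: odometer_def)
    then show ?thesis
      using toeplitz_dvd[OF assms(1) that] by (metis mod_add_eq mod_mod_cancel of_nat_dvd_iff)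
  qed
  then show ?thesis
    using toeplitz_pos[OF assms(1)] by (auto simp: odometer_def odo_add_def)
qed

lemma odo_add_0: "g \<in> odometer p \<Longrightarrow> odo_add p g (odo_Delta p 0) = g"
  by (auto simp: odo_add_def odo_Delta_def odometer_mod)

lemma odo_add_Delta_Delta:
  "odo_add p (odo_add p g (odo_Delta p j)) (odo_Delta p k) = odo_add p g (odo_Delta p (j + k))"
  by (simp add: odo_add_def odo_Delta_def mod_simps add.assoc)

lemma per_part_mono:
  assumes "toeplitz \<eta> p" "m \<le> n" shows "per_part \<eta> p i m \<subseteq> per_part \<eta> p i n"
proof
  fix k assume k: "k \<in> per_part \<eta> p i m"
  obtain c where c: "p n = p m * c" using toeplitz_dvd[OF assms] by blast
  have "\<eta> (k + int (p n) * j) = i" for j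
    using k c by (auto simp: per_part_def mult.assoc dest: spec[of _ "int c * j"])
  then show "k \<in> per_part \<eta> p i n" by (simp add: per_part_def)
qed

lemma holes_antimono: "toeplitz \<eta> p \<Longrightarrow> m \<le> n \<Longrightarrow> holes \<eta> p n \<subseteq> holes \<eta> p m"
  unfolding holes_def by (intro Compl_anti_mono Un_mono per_part_mono)

lemma holes_mod: "k mod int (p n) \<in> holes \<eta> p n \<longleftrightarrow> k \<in> holes \<eta> p n"
  using per_part_mod[of k \<eta> p] by (simp add: holes_def)

text \<open>A class on which \<open>\<eta>\<close> avoids one of the two symbols is constant, hence
  contains no hole.\<close>

lemma hole_attains:
  assumes "toeplitz \<eta> p" "k \<in> holes \<eta> p n" "i \<in> {0, 1}"
  shows "\<exists>m. m mod int (p n) = k mod int (p n) \<and> \<eta> m = i"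
proof -
  have v: "\<eta> j \<in> {0, 1}" for j using assms(1) by (auto simp: toeplitz_def)
  \<comment> \<open>For \<open>i\<close> in {0, 1} the natural number \<open>1 - i\<close> is the
    other symbol.\<close>
  have "k \<notin> per_part \<eta> p (1 - i) n" using assms(2,3) by (auto simp: holes_def)
  then obtain j where "\<eta> (k + int (p n) * j) \<noteq> 1 - i" by (auto simp: per_part_def)
  then have "\<eta> (k + int (p n) * j) = i" using v[of "k + int (p n) * j"] assms(3) by auto
  then show ?thesis by (intro exI[of _ "k + int (p n) * j"]) simp
qed

lemma holes_nonempty:
  assumes "toeplitz \<eta> p" "\<not> periodic \<eta>" shows "holes \<eta> p n \<noteq> {}"
proof
  assume e: "holes \<eta> p n = {}"
  have "\<eta> (k + int (p n)) = \<eta> k" for k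
  proof -
    obtain i where "k \<in> per_part \<eta> p i n" using e by (auto simp: holes_def)
    then have "\<forall>j. \<eta> (k + int (p n) * j) = i" by (simp add: per_part_def)
    from this[rule_format, of 0] this[rule_format, of 1] show ?thesis by simp
  qed
  then show False
    using assms(2) toeplitz_pos[OF assms(1), of n] unfolding periodic_def by (metis of_nat_0_less_iff)
qed

text \<open>This replaces the topological boundary by a condition on coordinates; all later
  arguments about it use this form.\<close>

lemma bd_W_iff:
  assumes "toeplitz \<eta> p"
  shows "g \<in> bd_W \<eta> p \<longleftrightarrow> g \<in> odometer p \<and> (\<forall>n. g n \<in> holes \<eta> p n)"
  using assms by (auto simp: bd_W_eq V_set_iff holes_def)

text \<open>For each level \<open>n\<close> from \<open>N\<close> on, the coordinate
  \<open>g n\<close> is itself a hole in the class of \<open>k\<close> modulo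
  \<open>p N\<close>.\<close>

lemma bd_W_imp_ess_holes:
  assumes "toeplitz \<eta> p" "g \<in> bd_W \<eta> p" "k mod int (p N) = g N"
  shows "k \<in> ess_holes \<eta> p N"
proof -
  have g: "g \<in> odometer p" "\<And>n. g n \<in> holes \<eta> p n"
    using assms(1,2) by (auto simp: bd_W_iff)
  have "holes \<eta> p n \<inter> range (\<lambda>j. k + int (p N) * j) \<noteq> {}" if "N \<le> n" for n
  proof -
    have "g n mod int (p N) = k mod int (p N)" using g(1) that assms(3) by (auto simp: odometer_def)
    then obtain j where "g n = k + int (p N) * j" by (metis mod_eqE)
    then show ?thesis using g(2)[of n] by auto
  qed
  moreover have "k \<in> holes \<eta> p N" using g(2)[of N] assms(3) holes_mod by metis
  ultimately show ?thesis by (auto simp: ess_holes_def)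
qed

text \<open>By compactness: deep holes in the class of \<open>k\<close> give points
  \<open>odo_Delta\<close> that satisfy any finite part of the conditions defining the boundary
  point.\<close>

lemma ess_holes_imp_bd_W:
  assumes "toeplitz \<eta> p" "compact (odometer p)" "k \<in> ess_holes \<eta> p N"
  shows "\<exists>g\<in>bd_W \<eta> p. g N = k mod int (p N)"
proof -
  define C where "C n = {g. g n \<in> holes \<eta> p n \<and> g N = k mod int (p N)}" for n
  have "closed (C n)" for n
  proof -
    have "C n = ((\<lambda>g. g n) -` holes \<eta> p n) \<inter> ((\<lambda>g. g N) -` {k mod int (p N)})"
      by (auto simp: C_def)
    then show ?thesis by (simp add: closed_Int closed_coordinate_vimage)
  qed
  moreover have "\<exists>g\<in>odometer p. \<forall>m\<le>n. g \<in> C m" for n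
  proof -
    \<comment> \<open>Essential holes promise holes only from level \<open>N\<close> on, hence the
      maximum; a hole at this level is a hole at all lower levels too.\<close>
    obtain j where j: "k + int (p N) * j \<in> holes \<eta> p (max n N)"
      using assms(3) max.cobounded2[of N n] unfolding ess_holes_def by blast
    have "odo_Delta p (k + int (p N) * j) \<in> C m" if "m \<le> n" for m
    proof -
      have "holes \<eta> p (max n N) \<subseteq> holes \<eta> p m"
        using holes_antimono[OF assms(1)] that by simp
      then show ?thesis using j by (auto simp: C_def odo_Delta_def holes_mod)
    qed
    then show ?thesis using odo_Delta_in[OF assms(1)] by blast
  qed
  ultimately obtain g where "g \<in> odometer p" "\<forall>n. g \<in> C n"
    using compact_sequence_intersection[OF assms(2), of C] by blast
  then show ?thesis unfolding bd_W_iff[OF assms(1)] C_def Bex_def by blast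
qed

lemma ess_holes_iff:
  assumes "toeplitz \<eta> p" "compact (odometer p)"
  shows "k \<in> ess_holes \<eta> p N \<longleftrightarrow> (\<exists>g\<in>bd_W \<eta> p. g N = k mod int (p N))"
  using bd_W_imp_ess_holes[OF assms(1)] ess_holes_imp_bd_W[OF assms] by metis

lemma bd_W_nonempty:
  assumes "toeplitz \<eta> p" "\<not> periodic \<eta>" "compact (odometer p)"
  shows "bd_W \<eta> p \<noteq> {}"
proof -
  have "closed ((\<lambda>g::nat \<Rightarrow> int. g n) -` holes \<eta> p n)" for n
    by (rule closed_coordinate_vimage)
  moreover have "\<exists>g\<in>odometer p. \<forall>m\<le>n. g \<in> (\<lambda>g. g m) -` holes \<eta> p m" for n
  proof -
    obtain k where "k \<in> holes \<eta> p n" using holes_nonempty[OF assms(1,2)] by blast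
    then have "\<forall>m\<le>n. odo_Delta p k m \<in> holes \<eta> p m"
      using holes_antimono[OF assms(1)] by (auto simp: odo_Delta_def holes_mod)
    then show ?thesis using odo_Delta_in[OF assms(1)] by blast
  qed
  ultimately obtain g where "g \<in> odometer p" "\<forall>n. g \<in> (\<lambda>g. g n) -` holes \<eta> p n"
    using compact_sequence_intersection[OF assms(3), of "\<lambda>n. (\<lambda>g. g n) -` holes \<eta> p n"] by blast
  then have "g \<in> bd_W \<eta> p" by (simp add: bd_W_iff[OF assms(1)])
  then show ?thesis by blast
qed

subsection \<open>Periods of sets of integers\<close>

lemma period_iff_translate:
  fixes S :: "int set"
  shows "(\<lambda>k. k + t) ` S = S \<longleftrightarrow> (\<forall>k. k + t \<in> S \<longleftrightarrow> k \<in> S)"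
proof -
  have "k \<in> (\<lambda>k. k + t) ` S \<longleftrightarrow> k - t \<in> S" for k
    by (metis (no_types, lifting) add_diff_cancel_right' diff_add_cancel image_iff)
  then have "(\<lambda>k. k + t) ` S = S \<longleftrightarrow> (\<forall>k. k - t \<in> S \<longleftrightarrow> k \<in> S)" by (simp add: set_eq_iff)
  also have "\<dots> \<longleftrightarrow> (\<forall>k. k + t \<in> S \<longleftrightarrow> k \<in> S)"
    by (metis add_diff_cancel_right' diff_add_cancel)
  finally show ?thesis .
qed

lemma translate_iff_multiple:
  fixes S :: "int set"
  assumes "\<And>k. k + t \<in> S \<longleftrightarrow> k \<in> S"
  shows "k + t * j \<in> S \<longleftrightarrow> k \<in> S"
proof (induction j rule: int_induct[of _ 0])
  case (step1 i)
  then show ?case using assms[of "k + t * i"] by (simp add: algebra_simps)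
next
  case (step2 i)
  then show ?case using assms[of "k + t * (i - 1)"] by (simp add: algebra_simps)
qed simp

text \<open>Division with remainder: the remainder of \<open>d\<close> modulo the minimal period is
  again a period, and being smaller it must be 0. The positive period \<open>q\<close> ensures that
  the least one exists.\<close>

lemma minimal_period_dvd:
  assumes "0 < q" "(\<lambda>k. k + int q) ` S = S" "(\<lambda>k. k + d) ` S = S"
  shows "int (minimal_period S) dvd d"
proof -
  define t where "t = minimal_period S"
  have t: "0 < t" "(\<lambda>k. k + int t) ` S = S"
    using LeastI[of "\<lambda>t. 0 < t \<and> (\<lambda>k. k + int t) ` S = S" q] assms(1,2)
    by (auto simp: t_def minimal_period_def)
  define r where "r = nat (d mod int t)"
  have r: "int r = d + int t * (- (d div int t))"
    using t(1) by (simp add: r_def minus_mult_div_eq_mod)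
  have "k + int r \<in> S \<longleftrightarrow> k \<in> S" for k
    using translate_iff_multiple[of "int t" S "k + d" "- (d div int t)"] t(2) assms(3)
    unfolding r period_iff_translate add.assoc[symmetric] by blast
  then have "(\<lambda>k. k + int r) ` S = S" by (simp add: period_iff_translate)
  moreover have "r < t" using t(1) by (simp add: r_def nat_less_iff)
  ultimately have "r = 0"
    using not_less_Least[of r "\<lambda>t. 0 < t \<and> (\<lambda>k. k + int t) ` S = S"]
    by (auto simp: t_def minimal_period_def)
  then have "d = int t * (d div int t)" using r by simp
  then show ?thesis unfolding t_def[symmetric] by (metis dvd_triv_left)
qed

text \<open>Modulo \<open>q\<close>, translation by \<open>d\<close> is an injective self-map of a
  finite set of residues, so mapping into the set already means mapping onto it.\<close>

lemma translate_subset_imp_eq: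
  fixes S :: "int set"
  assumes "0 < q" "\<And>k. k + int q \<in> S \<longleftrightarrow> k \<in> S" "\<And>k. k \<in> S \<Longrightarrow> k + d \<in> S"
  shows "(\<lambda>k. k + d) ` S = S"
proof -
  have iter: "k + d * int n \<in> S" if "k \<in> S" for k n
  proof (induction n)
    case (Suc n)
    then show ?case using assms(3)[of "k + d * int n"] by (simp add: algebra_simps)
  qed (use that in simp)
  have "k \<in> S" if "k + d \<in> S" for k
  proof -
    \<comment> \<open>With these \<open>q - 1\<close> further steps the total displacement from
      \<open>k\<close> is \<open>q * d\<close>, which the period \<open>q\<close> cancels.\<close>
    have "k + d + d * int (q - 1) \<in> S" using iter[OF that] .
    then have "k + int q * d \<in> S" using assms(1) by (simp add: algebra_simps of_nat_diff)
    then show ?thesis using translate_iff_multiple[OF assms(2)] by simp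
  qed
  then show ?thesis unfolding period_iff_translate using assms(3) by blast
qed

lemma ess_holes_period:
  assumes "toeplitz \<eta> p" "compact (odometer p)"
  shows "k + int (p n) \<in> ess_holes \<eta> p n \<longleftrightarrow> k \<in> ess_holes \<eta> p n"
  by (simp add: ess_holes_iff[OF assms])

subsection \<open>The factor map onto the odometer\<close>

lemma orbit_in_orbit_closure: "(\<lambda>k. \<eta> (k + m)) \<in> orbit_closure \<eta>"
  unfolding orbit_closure_def by (rule subsetD[OF closure_subset]) blast

lemma self_in_orbit_closure: "\<eta> \<in> orbit_closure \<eta>"
  using orbit_in_orbit_closure[of \<eta> 0] by simp

lemma orbit_closure_translate:
  assumes "x \<in> orbit_closure \<eta>" shows "(\<lambda>k. x (k + m)) \<in> orbit_closure \<eta>"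
proof -
  let ?s = "\<lambda>x k. x (k + m)"
  have "continuous_on UNIV (?s :: (int \<Rightarrow> nat) \<Rightarrow> _)"
    by (intro continuous_intros) simp
  moreover have "?s ` range (\<lambda>m k. \<eta> (k + m)) \<subseteq> orbit_closure \<eta>"
    using orbit_in_orbit_closure by (auto simp: add.assoc)
  ultimately have "?s ` orbit_closure \<eta> \<subseteq> orbit_closure \<eta>"
    unfolding orbit_closure_def
    by (intro image_closure_subset) (auto intro: continuous_on_subset)
  then show ?thesis using assms by auto
qed

text \<open>The space \<open>int \<Rightarrow> nat\<close> is not compact, but a two-valued
  \<open>\<eta>\<close> confines its orbit closure to the compact cube of 0-1 sequences.\<close>

lemma compact_orbit_closure:
  assumes "range \<eta> \<subseteq> {0, 1}" shows "compact (orbit_closure \<eta>)"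
proof -
  have c: "compact (Pi\<^sub>E UNIV (\<lambda>_::int. {0::nat, 1}))" by (rule compact_PiE_UNIV) simp
  have "range (\<lambda>m k. \<eta> (k + m)) \<subseteq> Pi\<^sub>E UNIV (\<lambda>_. {0, 1})"
    using assms by (auto simp: PiE_iff image_subset_iff)
  moreover have "closed (\<Inter>i. (\<lambda>x::int \<Rightarrow> nat. x i) -` {0, 1})"
    by (intro closed_INT ballI closed_coordinate_vimage)
  moreover have "(\<Inter>i. (\<lambda>x::int \<Rightarrow> nat. x i) -` {0, 1}) = Pi\<^sub>E UNIV (\<lambda>_. {0, 1})"
    by (auto simp: PiE_iff)
  ultimately have "orbit_closure \<eta> \<subseteq> Pi\<^sub>E UNIV (\<lambda>_. {0, 1})"
    unfolding orbit_closure_def by (metis closure_minimal)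
  then show ?thesis
    using compact_Int_closed[OF c, of "orbit_closure \<eta>"]
    by (simp add: orbit_closure_def inf.absorb2)
qed

context
  fixes \<eta> :: "int \<Rightarrow> nat" and p :: "nat \<Rightarrow> nat" and \<pi> :: "(int \<Rightarrow> nat) \<Rightarrow> (nat \<Rightarrow> int)"
  assumes toep: "toeplitz \<eta> p"
    and factor: "factor_map (orbit_closure \<eta>) shift (odometer p) (odo_rot p) \<pi>"
    and base: "\<pi> \<eta> = odo_Delta p 0"
begin

lemma pi_in: "x \<in> orbit_closure \<eta> \<Longrightarrow> \<pi> x \<in> odometer p"
  using factor by (auto simp: factor_map_def)

lemma pi_translate:
  assumes "x \<in> orbit_closure \<eta>"
  shows "\<pi> (\<lambda>k. x (k + m)) = odo_add p (\<pi> x) (odo_Delta p m)"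
proof -
  have step: "\<pi> (\<lambda>k. x (k + (i + 1))) = odo_add p (\<pi> (\<lambda>k. x (k + i))) (odo_Delta p 1)" for i
  proof -
    have "\<pi> (shift (\<lambda>k. x (k + i))) = odo_rot p (\<pi> (\<lambda>k. x (k + i)))"
      using factor orbit_closure_translate[OF assms] by (auto simp: factor_map_def)
    then show ?thesis by (simp add: shift_def odo_rot_def ac_simps)
  qed
  have in_odo: "\<pi> (\<lambda>k. x (k + i)) \<in> odometer p" for i
    using pi_in orbit_closure_translate[OF assms] by blast
  show ?thesis
  proof (induction m rule: int_induct[of _ 0])
    case base
    then show ?case using odo_add_0 pi_in[OF assms] by simp
  next
    case (step1 i)
    then show ?case using step[of i] by (simp add: odo_add_Delta_Delta)
  next
    case (step2 i)
    \<comment> \<open>Equivariance only moves forward, so the downward step applies it from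
      \<open>i - 1\<close> to \<open>i\<close> and then cancels the added 1.\<close>
    have "odo_add p (odo_add p (\<pi> (\<lambda>k. x (k + (i - 1)))) (odo_Delta p 1)) (odo_Delta p (-1))
        = odo_add p (\<pi> x) (odo_Delta p (i - 1))"
      using step[of "i - 1"] step2(2) odo_add_Delta_Delta[of p "\<pi> x" i "-1"] by simp
    then show ?case using odo_add_0[OF in_odo] by (simp add: odo_add_Delta_Delta)
  qed
qed

lemma pi_orbit: "\<pi> (\<lambda>k. \<eta> (k + m)) = odo_Delta p m"
  using pi_translate[OF self_in_orbit_closure]
  by (simp add: base odo_add_def odo_Delta_def mod_simps)

lemma continuous_on_pi_coordinate: "continuous_on (orbit_closure \<eta>) (\<lambda>x. \<pi> x n)"
  using factor by (auto simp: factor_map_def intro: continuous_on_product_then_coordinatewise)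

lemma continuous_on_eval: "continuous_on S (\<lambda>x::int \<Rightarrow> nat. x k)"
  by (rule continuous_on_subset[OF continuous_on_product_coordinates]) simp

text \<open>Some translate of \<open>\<eta>\<close> agrees with \<open>x\<close> both in the
  \<open>n\<close>-th coordinate of its image and in the value at \<open>k\<close>. For the
  translate, that coordinate places the position in the periodic part, which fixes the
  value.\<close>

lemma value_determined_by_pi:
  assumes "x \<in> orbit_closure \<eta>" "odo_add p (\<pi> x) (odo_Delta p k) \<in> V_set \<eta> p i"
  shows "x k = i"
proof -
  obtain n where "odo_add p (\<pi> x) (odo_Delta p k) n \<in> per_part \<eta> p i n"
    using assms(2) toep by (auto simp: V_set_iff)
  then have n: "\<pi> x n + k \<in> per_part \<eta> p i n"
    by (simp add: odo_add_def odo_Delta_def mod_simps per_part_mod[of "\<pi> x n + k"])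
  have "continuous_on (orbit_closure \<eta>) (\<lambda>z. (\<pi> z n, z k))"
    by (intro continuous_on_Pair continuous_on_pi_coordinate continuous_on_eval)
  moreover have "open {(\<pi> x n, x k)}"
    using open_Times[of "{\<pi> x n}" "{x k}"] by (simp add: open_discrete)
  ultimately obtain m where m: "\<pi> (\<lambda>k. \<eta> (k + m)) n = \<pi> x n" "\<eta> (k + m) = x k"
    using closure_attains_isolated_value[of _ "\<lambda>z. (\<pi> z n, z k)" x] assms(1)
    unfolding orbit_closure_def by blast
  have "m mod int (p n) = \<pi> x n" using m(1) by (simp add: pi_orbit odo_Delta_def)
  then have "(m + k) mod int (p n) = (\<pi> x n + k) mod int (p n)" by (metis mod_add_left_eq)
  then have "m + k \<in> per_part \<eta> p i n" using n per_part_mod by metis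
  then have "\<eta> (m + k) = i" by (auto simp: per_part_def dest: spec[of _ 0])
  then show ?thesis using m(2) by (simp add: add.commute)
qed

text \<open>Since \<open>g n\<close> is a hole, its class modulo \<open>p n\<close> contains some
  \<open>l\<close> with \<open>\<eta> l = i\<close>. Translating \<open>\<eta>\<close> by
  \<open>l\<close> gives the right symbol at 0 and the right coordinates up to \<open>n\<close>;
  compactness handles all levels together.\<close>

lemma fibre_over_bd_W:
  assumes "g \<in> bd_W \<eta> p" "i \<in> {0, 1}"
  shows "\<exists>x\<in>orbit_closure \<eta>. \<pi> x = g \<and> x 0 = i"
proof -
  have g: "g \<in> odometer p" "\<And>n. g n \<in> holes \<eta> p n" using assms(1) toep by (auto simp: bd_W_iff)
  define C where "C n = orbit_closure \<eta> \<inter> (\<lambda>x. (\<pi> x n, x 0)) -` {(g n, i)}" for n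
  have "closed (C n)" for n
    unfolding C_def
    by (intro continuous_closed_preimage continuous_on_Pair continuous_on_pi_coordinate
        continuous_on_eval closed_singleton) (simp add: orbit_closure_def)
  moreover have "\<exists>x\<in>orbit_closure \<eta>. \<forall>m\<le>n. x \<in> C m" for n
  proof -
    obtain l where l: "l mod int (p n) = g n mod int (p n)" "\<eta> l = i"
      using hole_attains[OF toep g(2) assms(2)] by blast
    have "odo_Delta p l m = g m" if "m \<le> n" for m
    proof -
      have "g n mod int (p m) = g m" using g(1) that by (auto simp: odometer_def)
      then show ?thesis
        using l(1) toeplitz_dvd[OF toep that]
        unfolding odo_Delta_def by (metis mod_mod_cancel of_nat_dvd_iff)
    qed
    then have "\<forall>m\<le>n. (\<lambda>k. \<eta> (k + l)) \<in> C m"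
      using l(2) orbit_in_orbit_closure by (simp add: C_def pi_orbit)
    then show ?thesis using orbit_in_orbit_closure by blast
  qed
  moreover have "compact (orbit_closure \<eta>)"
    using toep by (intro compact_orbit_closure) (simp add: toeplitz_def)
  ultimately obtain x where "x \<in> orbit_closure \<eta>" "\<forall>n. x \<in> C n"
    using compact_sequence_intersection by blast
  then show ?thesis by (auto simp: C_def)
qed

section \<open>Automorphisms and the rotations they induce on the odometer\<close>

context
  fixes F :: "(int \<Rightarrow> nat) \<Rightarrow> (int \<Rightarrow> nat)"
  assumes aut: "automorphism_on (orbit_closure \<eta>) shift F"
begin

lemma F_in: "x \<in> orbit_closure \<eta> \<Longrightarrow> F x \<in> orbit_closure \<eta>"
  using aut by (auto simp: automorphism_on_def homeomorphism_def)

lemma F_inj: "inj_on F (orbit_closure \<eta>)"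
  using aut by (auto simp: automorphism_on_def homeomorphism_def intro: inj_on_inverseI)

lemma F_continuous: "continuous_on (orbit_closure \<eta>) F"
  using aut by (auto simp: automorphism_on_def homeomorphism_def)

lemma F_translate:
  assumes "x \<in> orbit_closure \<eta>"
  shows "F (\<lambda>k. x (k + m)) = (\<lambda>k. F x (k + m))"
proof -
  have step: "F (\<lambda>k. x (k + (i + 1))) k = F (\<lambda>k. x (k + i)) (k + 1)" for i k
  proof -
    have "F (shift (\<lambda>k. x (k + i))) = shift (F (\<lambda>k. x (k + i)))"
      using aut orbit_closure_translate[OF assms] by (auto simp: automorphism_on_def)
    then show ?thesis by (simp add: shift_def fun_eq_iff ac_simps)
  qed
  have "\<forall>k. F (\<lambda>k. x (k + m)) k = F x (k + m)"
  proof (induction m rule: int_induct[of _ 0])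
    case (step1 i)
    then show ?case using step[of i] by (simp add: ac_simps)
  next
    case (step2 i)
    have "F (\<lambda>k. x (k + (i - 1))) k = F x (k + (i - 1))" for k
      using step[of "i - 1" "k - 1"] step2(2)[THEN spec, of "k - 1"] by (simp add: algebra_simps)
    then show ?case by blast
  qed simp
  then show ?thesis by blast
qed

text \<open>Both sides commute with translation, so they agree on the orbit of
  \<open>\<eta>\<close>; coordinates are discrete and continuous, so agreement extends to the
  closure.\<close>

lemma pi_F_eq:
  assumes "x \<in> orbit_closure \<eta>"
  shows "\<pi> (F x) = odo_add p (\<pi> x) (\<pi> (F \<eta>))"
proof
  fix n
  have "continuous_on (orbit_closure \<eta>) (\<lambda>z. \<pi> (F z) n)"
    using continuous_on_compose2[OF continuous_on_pi_coordinate F_continuous] F_in by blast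
  then have "continuous_on (orbit_closure \<eta>) (\<lambda>z. (\<pi> z n, \<pi> (F z) n))"
    by (intro continuous_on_Pair continuous_on_pi_coordinate)
  moreover have "open {(\<pi> x n, \<pi> (F x) n)}"
    using open_Times[of "{\<pi> x n}" "{\<pi> (F x) n}"] by (simp add: open_discrete)
  ultimately obtain m where
    m: "\<pi> (\<lambda>k. \<eta> (k + m)) n = \<pi> x n" "\<pi> (F (\<lambda>k. \<eta> (k + m))) n = \<pi> (F x) n"
    using closure_attains_isolated_value[of _ "\<lambda>z. (\<pi> z n, \<pi> (F z) n)" x] assms
    unfolding orbit_closure_def by blast
  show "\<pi> (F x) n = odo_add p (\<pi> x) (\<pi> (F \<eta>)) n"
    using m(1) unfolding m(2)[symmetric]
    by (simp add: F_translate self_in_orbit_closure pi_translate F_in pi_orbit odo_add_def add.commute)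
qed

lemma odo_shift_of_eq: "odo_shift_of p (orbit_closure \<eta>) \<pi> F = \<pi> (F \<eta>)"
  unfolding odo_shift_of_def
proof (rule the_equality)
  show "\<pi> (F \<eta>) \<in> odometer p \<and>
      (\<forall>x\<in>orbit_closure \<eta>. \<pi> (F x) = odo_add p (\<pi> x) (\<pi> (F \<eta>)))"
    using pi_F_eq pi_in F_in self_in_orbit_closure by blast
next
  fix y assume y: "y \<in> odometer p \<and> (\<forall>x\<in>orbit_closure \<eta>. \<pi> (F x) = odo_add p (\<pi> x) y)"
  then have "\<pi> (F \<eta>) = odo_add p (odo_Delta p 0) y"
    using self_in_orbit_closure base by metis
  then show "y = \<pi> (F \<eta>)"
    using y by (auto simp: odo_add_def odo_Delta_def odometer_mod)
qed

text \<open>Two points over \<open>g\<close> differ at position 0. If no translate of the shifted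
  point met the boundary, that point would determine every symbol of both images under
  \<open>F\<close>, against injectivity.\<close>

lemma bd_W_add_shift:
  assumes "g \<in> bd_W \<eta> p"
  shows "\<exists>j. odo_add p (odo_add p g (odo_shift_of p (orbit_closure \<eta>) \<pi> F)) (odo_Delta p j)
    \<in> bd_W \<eta> p"
proof (rule ccontr)
  define h where "h = odo_add p g (\<pi> (F \<eta>))"
  assume "\<not> ?thesis"
  then have none: "odo_add p h (odo_Delta p j) \<notin> bd_W \<eta> p" for j
    by (simp add: odo_shift_of_eq h_def)
  obtain x0 x1 where x: "x0 \<in> orbit_closure \<eta>" "\<pi> x0 = g" "x0 0 = 0"
    "x1 \<in> orbit_closure \<eta>" "\<pi> x1 = g" "x1 0 = 1"
    using fibre_over_bd_W[OF assms, of 0] fibre_over_bd_W[OF assms, of 1] by auto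
  have Fx: "\<pi> (F x0) = h" "\<pi> (F x1) = h" using x pi_F_eq by (auto simp: h_def)
  have "h \<in> odometer p" using Fx(1) pi_in F_in x(1) by blast
  have "F x0 j = F x1 j" for j
  proof -
    have "odo_add p h (odo_Delta p j) \<in> V_set \<eta> p 0 \<union> V_set \<eta> p 1"
      using none[of j] odo_add_in[OF toep \<open>h \<in> odometer p\<close> odo_Delta_in[OF toep]]
      by (auto simp: bd_W_eq[OF toep])
    then obtain i where "odo_add p h (odo_Delta p j) \<in> V_set \<eta> p i" by blast
    then show ?thesis
      using value_determined_by_pi[OF F_in] Fx x by metis
  qed
  then have "x0 = x1" using F_inj x(1,4) by (auto dest: inj_onD)
  then show False using x by simp
qed

end

end

theorem proposition2p20:
  fixes \<eta> :: "int \<Rightarrow> nat" and p :: "nat \<Rightarrow> nat" and A :: "nat \<Rightarrow> nat set"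
    and \<pi> :: "(int \<Rightarrow> nat) \<Rightarrow> (nat \<Rightarrow> int)" and F :: "(int \<Rightarrow> nat) \<Rightarrow> (int \<Rightarrow> nat)"
    and y\<^sub>F :: "nat \<Rightarrow> int"
  assumes "toeplitz \<eta> p" and "\<not> periodic \<eta>"
    and "maximal_equicontinuous_factor (orbit_closure \<eta>) shift (odometer p) (odo_rot p) \<pi>"
    and "\<pi> \<eta> = odo_Delta p 0"
    and "automorphism_on (orbit_closure \<eta>) shift F"
    and "y\<^sub>F = odo_shift_of p (orbit_closure \<eta>) \<pi> F"
    and "\<And>n. A n \<subseteq> {1..}"
    and "(\<Inter>n. group_closure (int ` A n)) = {0}"
    and "\<And>n. ess_holes \<eta> p n \<subseteq> multiples (A n)"
  shows "(\<forall>k. k \<noteq> 0 \<longrightarrow>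
            bd_W \<eta> p \<inter> (\<lambda>g. odo_diff p g (odo_Delta p k)) ` bd_W \<eta> p = {}) \<and>
         (\<exists>!k. (\<lambda>g. odo_add p g y\<^sub>F) ` bd_W \<eta> p
                 \<subseteq> (\<lambda>g. odo_add p g (odo_Delta p k)) ` bd_W \<eta> p) \<and>
         (\<forall>k. (\<lambda>g. odo_add p g y\<^sub>F) ` bd_W \<eta> p
                 \<subseteq> (\<lambda>g. odo_add p g (odo_Delta p k)) ` bd_W \<eta> p \<longrightarrow>
            (\<forall>n. residue_dvd (p n) (minimal_period (ess_holes \<eta> p n)) (y\<^sub>F n - k)) \<and>
            (infinite {n. minimal_period (ess_holes \<eta> p n) = p n} \<longrightarrow> y\<^sub>F = odo_Delta p k))"
proof -
  have odo: "compact (odometer p)"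
    using assms(3) by (simp add: maximal_equicontinuous_factor_def equicontinuous_system_def)
  have factor: "factor_map (orbit_closure \<eta>) shift (odometer p) (odo_rot p) \<pi>"
    using assms(3) by (simp add: maximal_equicontinuous_factor_def)
  note toep = assms(1)
  define B where "B = bd_W \<eta> p"
  define H where "H n = group_closure (int ` A n)" for n
  have y_in: "y\<^sub>F \<in> odometer p"
    using odo_shift_of_eq[OF toep factor assms(4,5)] pi_in[OF toep factor assms(4)]
      F_in[OF toep factor assms(4,5)] self_in_orbit_closure assms(6) by metis
  have B_odo: "g \<in> odometer p" if "g \<in> B" for g
    using that toep by (simp add: B_def bd_W_iff)
  have ess_H: "ess_holes \<eta> p n \<subseteq> H n" for n
  proof
    fix k assume "k \<in> ess_holes \<eta> p n"
    then have "k \<in> multiples (A n)" using assms(9) by blast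
    then obtain a j where "a \<in> A n" "k = int a * j" by (auto simp: multiples_def)
    then show "k \<in> H n" by (simp add: H_def group_closure_mult_left group_closure.base)
  qed
  have H_diff: "a - b \<in> H n" if "a \<in> H n" "b \<in> H n" for a b n
    using that group_closure.diff by (auto simp: H_def)
  have B_H: "g n \<in> H n" if "g \<in> B" for g n
    using that bd_W_imp_ess_holes[OF toep] ess_H odometer_mod B_odo by (metis B_def subsetD)
  \<comment> \<open>The period is a difference of two essential holes, \<open>g n\<close> and
    \<open>g n + p n\<close>. Hence reduction modulo \<open>p n\<close> does not leave a coset of
    \<open>H n\<close>.\<close>
  have p_H: "int (p n) * j \<in> H n" if "g \<in> B" for g n j
  proof -
    have "g n + int (p n) \<in> ess_holes \<eta> p n"
      using that bd_W_imp_ess_holes[OF toep, of g "g n + int (p n)" n] odometer_mod[OF B_odo[OF that]]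
      by (simp add: B_def)
    then have "int (p n) \<in> H n" using H_diff[OF _ B_H[OF that, of n]] ess_H by fastforce
    then show ?thesis by (simp add: H_def group_closure_mult_left)
  qed
  have mod_H: "a - b \<in> H n" if "a mod int (p n) = b mod int (p n)" "g \<in> B" for a b n g
    using that p_H[OF that(2)] by (metis dvd_def mod_eq_dvd_iff)
  have zero: "k = 0" if "\<And>n. k \<in> H n" for k
    using that assms(8) by (auto simp: H_def)

  have disj: "B \<inter> (\<lambda>g. odo_diff p g (odo_Delta p k)) ` B = {}" if "k \<noteq> 0" for k
  proof (rule ccontr)
    assume "\<not> ?thesis"
    then obtain g h where gh: "g \<in> B" "h \<in> B" "g = odo_diff p h (odo_Delta p k)" by blast
    have "k \<in> H n" for n
    proof -
      have "(h n - k) mod int (p n) = g n mod int (p n)"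
        using gh(3) by (simp add: odo_diff_def odo_Delta_def mod_simps)
      then have "(h n - k) - g n \<in> H n" using mod_H gh(1) by blast
      \<comment> \<open>The difference equals \<open>k\<close>, which therefore lies in every
        \<open>H n\<close>.\<close>
      then have "h n - g n - ((h n - k) - g n) \<in> H n" using H_diff B_H gh by blast
      then show ?thesis by simp
    qed
    then show False using zero that by blast
  qed

  have ex: "\<exists>k. odo_add p g y\<^sub>F \<in> (\<lambda>g. odo_add p g (odo_Delta p k)) ` B" if gB: "g \<in> B" for g
  proof -
    define z where "z = odo_add p g y\<^sub>F"
    obtain j where j: "odo_add p z (odo_Delta p j) \<in> B"
      using bd_W_add_shift[OF toep factor assms(4,5)] gB
      unfolding B_def assms(6) z_def by blast
    have "z \<in> odometer p" using odo_add_in[OF toep B_odo[OF gB] y_in] by (simp add: z_def)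
    then have "odo_add p (odo_add p z (odo_Delta p j)) (odo_Delta p (- j)) = z"
      by (simp add: odo_add_Delta_Delta odo_add_0)
    \<comment> \<open>The witness is \<open>- j\<close>: undoing the translation exhibits
      \<open>z\<close> as a boundary point plus an integer.\<close>
    then show ?thesis using j unfolding z_def[symmetric] by (metis image_eqI)
  qed

  have yk: "y\<^sub>F n - k \<in> H n"
    if "g \<in> B" and sub: "odo_add p g y\<^sub>F \<in> (\<lambda>g. odo_add p g (odo_Delta p k)) ` B" for g k n
  proof -
    obtain h where h: "h \<in> B" "odo_add p g y\<^sub>F = odo_add p h (odo_Delta p k)" using sub by blast
    have "(g n + y\<^sub>F n) mod int (p n) = (h n + k) mod int (p n)"
      using fun_cong[OF h(2), of n] by (simp add: odo_add_def odo_Delta_def mod_simps)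
    then have "(g n + y\<^sub>F n) - (h n + k) \<in> H n" using mod_H that(1) by blast
    then have "(g n + y\<^sub>F n) - (h n + k) - (g n - h n) \<in> H n"
      using H_diff B_H that(1) h(1) by blast
    then show ?thesis by (simp add: algebra_simps)
  qed
  \<comment> \<open>The points \<open>g\<close> and \<open>g'\<close> may differ: the coset of
    \<open>k\<close> modulo \<open>H n\<close> is that of \<open>y\<^sub>F n\<close> for either of
    them. So one integer serves the whole boundary, giving both existence and uniqueness.\<close>
  have uniq: "k = k'"
    if "g \<in> B" "odo_add p g y\<^sub>F \<in> (\<lambda>g. odo_add p g (odo_Delta p k)) ` B"
      "g' \<in> B" "odo_add p g' y\<^sub>F \<in> (\<lambda>g. odo_add p g (odo_Delta p k')) ` B" for g g' k k'
  proof -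
    have "k - k' \<in> H n" for n
      using H_diff[OF yk[OF that(3,4)] yk[OF that(1,2)], of n] by simp
    then have "k - k' = 0" by (rule zero)
    then show ?thesis by simp
  qed

  obtain g0 where g0: "g0 \<in> B" using bd_W_nonempty[OF toep assms(2) odo] by (auto simp: B_def)
  obtain k0 where k0: "odo_add p g0 y\<^sub>F \<in> (\<lambda>g. odo_add p g (odo_Delta p k0)) ` B"
    using ex[OF g0] by blast
  have unique: "\<exists>!k. (\<lambda>g. odo_add p g y\<^sub>F) ` B \<subseteq> (\<lambda>g. odo_add p g (odo_Delta p k)) ` B"
  proof (rule ex1I[of _ k0])
    show "(\<lambda>g. odo_add p g y\<^sub>F) ` B \<subseteq> (\<lambda>g. odo_add p g (odo_Delta p k0)) ` B"
      using ex uniq[OF g0 k0] by blast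
  next
    fix k assume "(\<lambda>g. odo_add p g y\<^sub>F) ` B \<subseteq> (\<lambda>g. odo_add p g (odo_Delta p k)) ` B"
    then show "k = k0" using uniq[OF g0 _ g0 k0] g0 by blast
  qed

  have dvd: "int (minimal_period (ess_holes \<eta> p n)) dvd y\<^sub>F n - k"
    if sub: "(\<lambda>g. odo_add p g y\<^sub>F) ` B \<subseteq> (\<lambda>g. odo_add p g (odo_Delta p k)) ` B" for k n
  proof (rule minimal_period_dvd[OF toeplitz_pos[OF toep, of n]])
    show "(\<lambda>l. l + int (p n)) ` ess_holes \<eta> p n = ess_holes \<eta> p n"
      using ess_holes_period[OF toep odo] by (simp add: period_iff_translate)
    show "(\<lambda>l. l + (y\<^sub>F n - k)) ` ess_holes \<eta> p n = ess_holes \<eta> p n"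
    \<comment> \<open>Only an inclusion has to be checked: lift an essential hole to a boundary
      point, move it by \<open>y\<^sub>F\<close> and \<open>- k\<close>, and read off coordinate
      \<open>n\<close>.\<close>
    proof (rule translate_subset_imp_eq[OF toeplitz_pos[OF toep, of n] ess_holes_period[OF toep odo]])
      fix l assume "l \<in> ess_holes \<eta> p n"
      then obtain g where g: "g \<in> B" "g n = l mod int (p n)"
        using ess_holes_iff[OF toep odo] by (auto simp: B_def)
      obtain h where h: "h \<in> B" "odo_add p g y\<^sub>F = odo_add p h (odo_Delta p k)"
        using sub g(1) by blast
      have "(l + y\<^sub>F n) mod int (p n) = (h n + k) mod int (p n)"
        using fun_cong[OF h(2), of n] g(2) by (simp add: odo_add_def odo_Delta_def mod_simps)
      then have "(l + y\<^sub>F n - k) mod int (p n) = (h n + k - k) mod int (p n)"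
        by (metis mod_diff_left_eq)
      then have "(l + (y\<^sub>F n - k)) mod int (p n) = h n"
        using odometer_mod[OF B_odo[OF h(1)]] by (simp add: algebra_simps)
      then show "l + (y\<^sub>F n - k) \<in> ess_holes \<eta> p n"
        using bd_W_imp_ess_holes[OF toep] h(1) by (simp add: B_def)
    qed
  qed

  have y_eq: "y\<^sub>F = odo_Delta p k"
    if sub: "(\<lambda>g. odo_add p g y\<^sub>F) ` B \<subseteq> (\<lambda>g. odo_add p g (odo_Delta p k)) ` B"
      and inf: "infinite {n. minimal_period (ess_holes \<eta> p n) = p n}" for k
  proof
    fix m
    \<comment> \<open>Coordinate \<open>m\<close> is settled at a deeper level \<open>n\<close> with
      full minimal period, because \<open>p m\<close> divides \<open>p n\<close>.\<close>
    obtain n where n: "m \<le> n" "minimal_period (ess_holes \<eta> p n) = p n"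
      using inf unfolding infinite_nat_iff_unbounded_le by blast
    have "int (p m) dvd y\<^sub>F n - k"
      using dvd[OF sub, of n] n(2) toeplitz_dvd[OF toep n(1)] by (metis dvd_trans of_nat_dvd_iff)
    then have "y\<^sub>F n mod int (p m) = k mod int (p m)" by (simp add: mod_eq_dvd_iff)
    then show "y\<^sub>F m = odo_Delta p k m"
      using y_in n(1) by (auto simp: odometer_def odo_Delta_def)
  qed

  have res: "residue_dvd (p n) (minimal_period (ess_holes \<eta> p n)) (y\<^sub>F n - k)"
    if "(\<lambda>g. odo_add p g y\<^sub>F) ` B \<subseteq> (\<lambda>g. odo_add p g (odo_Delta p k)) ` B" for k n
    using dvd[OF that, of n] by (auto simp: residue_dvd_def dvd_def)
  show ?thesis
    unfolding B_def[symmetric] by (intro conjI allI impI disj unique res y_eq)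
qed

end
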